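(* Let $\mathbb{K}$ be an algebraically closed field of characteristic $\neq 2$ and let $\alpha_1\in\mathbb{K}$ with $\alpha_1\neq 0$. Then the algebra $\mathcal{D}_3(\alpha_1,-\alpha_1)$ is isomorphic to the product of three copies of the preprojective algebra of the Dynkin quiver of type $A_2$.
   Context: For $\alpha_1,\alpha_2\in\mathbb{K}$, $\mathcal{D}_3(\alpha_1,\alpha_2)$ denotes the associative unital $\mathbb{K}$-algebra given by generators $a,b,c$ and relations $$a^2=b^2=c^2=\alpha_1,\qquad ca+bc+ab=\alpha_2,\qquad cb+ba+ac=\alpha_2.$$ The preprojective algebra of type $A_2$ is the path algebra over $\mathbb{K}$ of the quiver with two vertices $1,2$, one arrow $x\colon 1\to 2$ and one arrow $x^*\colon 2\to 1$, modulo the relations that both paths of length two, $xx^*$ and $x^*x$, are zero. *)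

theory Defs
  imports
    "HOL-Computational_Algebra.Polynomial"
    "HOL-Library.Poly_Mapping"
    "HOL-Algebra.Module"
    "HOL-Algebra.QuotRing"
    "HOL-Algebra.Chinese_Remainder"
    "Graph_Theory.Arc_Walk"
begin

section \<open>Associative unital algebras over a field\<close>

text \<open>
  The scalars form a type \<open>'k\<close> of class \<open>field\<close>. An associative unital \<open>'k\<close>-algebra is
  represented by a record of type \<open>('k, 'a) module\<close>, that is, a ring record with an additional
  scalar multiplication. (The locale \<open>algebra\<close> of HOL-Algebra is not usable here, because it
  requires commutativity.)
\<close>

definition algebra_iso :: "('k, 'a) module \<Rightarrow> ('k, 'b) module \<Rightarrow> ('a \<Rightarrow> 'b) set" where
  "algebra_iso A B =
     {h \<in> ring_iso A B. \<forall>c. \<forall>x\<in>carrier A. h (c \<odot>\<^bsub>A\<^esub> x) = c \<odot>\<^bsub>B\<^esub> h x}"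

definition algebra_isomorphic :: "('k, 'a) module \<Rightarrow> ('k, 'b) module \<Rightarrow> bool" where
  "algebra_isomorphic A B \<longleftrightarrow> algebra_iso A B \<noteq> {}"

text \<open>
  A two-sided ideal of a unital algebra is closed under scalars, so the union below is the single
  coset of \<open>c \<odot> x\<close>, in analogy with \<^const>\<open>rcoset_mult\<close>.
\<close>
definition quot_algebra :: "('k, 'a) module \<Rightarrow> 'a set \<Rightarrow> ('k, 'a set) module" where
  "quot_algebra A I =
     ring.extend (A Quot I) \<lparr>smult = (\<lambda>c X. \<Union>x\<in>X. I +>\<^bsub>A\<^esub> (c \<odot>\<^bsub>A\<^esub> x))\<rparr>"

lemma quot_algebra_smult:
  assumes I: "ideal I A" and x: "x \<in> carrier A"
    and dist: "\<And>y. y \<in> carrier A \<Longrightarrow> c \<odot>\<^bsub>A\<^esub> (y \<oplus>\<^bsub>A\<^esub> x) = c \<odot>\<^bsub>A\<^esub> y \<oplus>\<^bsub>A\<^esub> c \<odot>\<^bsub>A\<^esub> x"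
    and clo: "\<And>y. y \<in> carrier A \<Longrightarrow> c \<odot>\<^bsub>A\<^esub> y \<in> carrier A"
    and assoc: "\<And>y. y \<in> carrier A \<Longrightarrow> c \<odot>\<^bsub>A\<^esub> y = (c \<odot>\<^bsub>A\<^esub> \<one>\<^bsub>A\<^esub>) \<otimes>\<^bsub>A\<^esub> y"
  shows "c \<odot>\<^bsub>quot_algebra A I\<^esub> (I +>\<^bsub>A\<^esub> x) = I +>\<^bsub>A\<^esub> (c \<odot>\<^bsub>A\<^esub> x)"
proof -
  interpret ideal I A by (rule I)
  have *: "I +>\<^bsub>A\<^esub> (c \<odot>\<^bsub>A\<^esub> y) = I +>\<^bsub>A\<^esub> (c \<odot>\<^bsub>A\<^esub> x)" if y: "y \<in> I +>\<^bsub>A\<^esub> x" for y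
  proof -
    obtain i where i: "i \<in> I" "y = i \<oplus>\<^bsub>A\<^esub> x" using y by (auto simp: a_r_coset_def')
    have "c \<odot>\<^bsub>A\<^esub> i \<in> I" using i by (subst assoc) (auto intro!: I_l_closed clo simp: Icarr)
    moreover have "c \<odot>\<^bsub>A\<^esub> y = c \<odot>\<^bsub>A\<^esub> i \<oplus>\<^bsub>A\<^esub> c \<odot>\<^bsub>A\<^esub> x" using i dist by (simp add: Icarr)
    ultimately have "c \<odot>\<^bsub>A\<^esub> y \<in> I +>\<^bsub>A\<^esub> (c \<odot>\<^bsub>A\<^esub> x)" by (auto simp: a_r_coset_def')
    then show ?thesis using a_repr_independence[OF _ clo[OF x] a_subgroup] by simp
  qed
  have "x \<in> I +>\<^bsub>A\<^esub> x" using x a_rcos_self by blast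
  then have "(\<Union>y\<in>I +>\<^bsub>A\<^esub> x. I +>\<^bsub>A\<^esub> (c \<odot>\<^bsub>A\<^esub> y)) = I +>\<^bsub>A\<^esub> (c \<odot>\<^bsub>A\<^esub> x)"
    using * by blast
  then show ?thesis by (simp add: quot_algebra_def ring.defs)
qed

definition prod_algebra :: "('k, 'a) module \<Rightarrow> ('k, 'b) module \<Rightarrow> ('k, 'a \<times> 'b) module" where
  "prod_algebra A B =
     ring.extend (RDirProd A B) \<lparr>smult = (\<lambda>c (x, y). (c \<odot>\<^bsub>A\<^esub> x, c \<odot>\<^bsub>B\<^esub> y))\<rparr>"


section \<open>Free algebras\<close>

text \<open>
  Lists under concatenation are the free monoid. Hence \<open>'g list \<Rightarrow>\<^sub>0 'k\<close>, with the convolution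
  product that the library provides over any additive monoid, is the free associative algebra on
  \<open>'g\<close>.
\<close>

instantiation list :: (type) monoid_add
begin

definition zero_list :: "'a list" where "zero_list = []"

definition plus_list :: "'a list \<Rightarrow> 'a list \<Rightarrow> 'a list" where "plus_list = (@)"

instance by standard (simp_all add: zero_list_def plus_list_def)

end

definition free_algebra :: "('k::field, 'g list \<Rightarrow>\<^sub>0 'k) module" where
  "free_algebra = \<lparr>carrier = UNIV, mult = (*), one = 1, zero = 0, add = (+),
                   smult = (\<lambda>c. Poly_Mapping.map ((*) c))\<rparr>"

lemma ring_free_algebra: "ring (free_algebra :: ('k::field, 'g list \<Rightarrow>\<^sub>0 'k) module)"
proof (rule ringI)
  show "abelian_group (free_algebra :: ('k, 'g list \<Rightarrow>\<^sub>0 'k) module)"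
    by (rule abelian_groupI) (auto simp: free_algebra_def algebra_simps intro: exI[of _ "- x" for x])
  show "Group.monoid (free_algebra :: ('k, 'g list \<Rightarrow>\<^sub>0 'k) module)"
    by (rule monoidI) (auto simp: free_algebra_def algebra_simps)
qed (auto simp: free_algebra_def algebra_simps)

definition free_gen :: "'g \<Rightarrow> 'g list \<Rightarrow>\<^sub>0 'k::field" where
  "free_gen g = Poly_Mapping.single [g] 1"

definition free_scalar :: "'k \<Rightarrow> 'g list \<Rightarrow>\<^sub>0 'k::field" where
  "free_scalar c = Poly_Mapping.single [] c"


section \<open>Path algebras\<close>

text \<open>
  A quiver is a finite directed multigraph. A path from \<open>u\<close> to \<open>v\<close> is a triple \<open>(u, p, v)\<close>, where
  \<open>p\<close> is the list of its arrows, in the order in which they are traversed; \<open>(v, [], v)\<close> is the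
  trivial path at \<open>v\<close>. The product of two paths is their concatenation (first factor traversed
  first) if the endpoints match, and zero otherwise.
\<close>

definition quiver_paths :: "('v, 'e) pre_digraph \<Rightarrow> ('v \<times> 'e list \<times> 'v) set" where
  "quiver_paths Q = {(u, p, v). pre_digraph.awalk Q u p v}"

definition path_mult ::
  "('v \<times> 'e list \<times> 'v \<Rightarrow>\<^sub>0 'k::field) \<Rightarrow> ('v \<times> 'e list \<times> 'v \<Rightarrow>\<^sub>0 'k) \<Rightarrow> ('v \<times> 'e list \<times> 'v \<Rightarrow>\<^sub>0 'k)"
where
  "path_mult f g =
     (\<Sum>(u, p, v)\<in>Poly_Mapping.keys f. \<Sum>(u', q, w)\<in>Poly_Mapping.keys g.
        if v = u'
        then Poly_Mapping.single (u, p @ q, w)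
               (Poly_Mapping.lookup f (u, p, v) * Poly_Mapping.lookup g (u', q, w))
        else 0)"

definition path_algebra :: "('v, 'e) pre_digraph \<Rightarrow> ('k::field, 'v \<times> 'e list \<times> 'v \<Rightarrow>\<^sub>0 'k) module" where
  "path_algebra Q = \<lparr>carrier = {f. Poly_Mapping.keys f \<subseteq> quiver_paths Q}, mult = path_mult,
                     one = (\<Sum>v\<in>verts Q. Poly_Mapping.single (v, [], v) 1), zero = 0, add = (+),
                     smult = (\<lambda>c. Poly_Mapping.map ((*) c))\<rparr>"

lemma path_mult_superset:
  assumes "finite A" "finite B" "Poly_Mapping.keys f \<subseteq> A" "Poly_Mapping.keys g \<subseteq> B"
  shows "path_mult f g =
    (\<Sum>(u, p, v)\<in>A. \<Sum>(u', q, w)\<in>B. if v = u' then Poly_Mapping.single (u, p @ q, w)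
       (Poly_Mapping.lookup f (u, p, v) * Poly_Mapping.lookup g (u', q, w)) else 0)"
  unfolding path_mult_def
proof (rule sum.mono_neutral_cong_left[OF assms(1,3)]; clarsimp)
  fix u p v assume "(u,p,v) \<notin> Poly_Mapping.keys f"
  then have 0: "Poly_Mapping.lookup f (u,p,v) = 0" by (simp add: in_keys_iff)
  show "(\<Sum>(u', q, w)\<in>B. if v = u' then Poly_Mapping.single (u, p @ q, w)
     (Poly_Mapping.lookup f (u, p, v) * Poly_Mapping.lookup g (u', q, w)) else 0) = 0"
    by (rule sum.neutral) (auto simp: 0)
next
  fix u p v
  show "(\<Sum>(u', q, w)\<in>Poly_Mapping.keys g. if v = u' then Poly_Mapping.single (u, p @ q, w)
     (Poly_Mapping.lookup f (u, p, v) * Poly_Mapping.lookup g (u', q, w)) else 0) =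
     (\<Sum>(u', q, w)\<in>B. if v = u' then Poly_Mapping.single (u, p @ q, w)
     (Poly_Mapping.lookup f (u, p, v) * Poly_Mapping.lookup g (u', q, w)) else 0)"
    by (rule sum.mono_neutral_left[OF assms(2,4)]) (auto simp: in_keys_iff)
qed

lemma path_mult_add_left: "path_mult (f + g) h = path_mult f h + path_mult g h"
proof -
  let ?A = "Poly_Mapping.keys f \<union> Poly_Mapping.keys g" and ?B = "Poly_Mapping.keys h"
  have *: "Poly_Mapping.keys (f + g) \<subseteq> ?A" by (rule Poly_Mapping.keys_add)
  show ?thesis
    by (subst (1 2 3) path_mult_superset[of ?A ?B])
       (use * in \<open>auto simp: sum.distrib[symmetric] lookup_add algebra_simps single_add intro!: sum.cong\<close>)
qed

lemma path_mult_add_right: "path_mult h (f + g) = path_mult h f + path_mult h g"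
proof -
  let ?A = "Poly_Mapping.keys f \<union> Poly_Mapping.keys g" and ?B = "Poly_Mapping.keys h"
  have *: "Poly_Mapping.keys (f + g) \<subseteq> ?A" by (rule Poly_Mapping.keys_add)
  show ?thesis
    by (subst (1 2 3) path_mult_superset[of ?B ?A])
       (use * in \<open>auto simp: sum.distrib[symmetric] lookup_add algebra_simps single_add intro!: sum.cong\<close>)
qed

lemma path_mult_single:
  "path_mult (Poly_Mapping.single (u, p, v) x) (Poly_Mapping.single (u', q, w) y) =
     (if v = u' then Poly_Mapping.single (u, p @ q, w) (x * y) else 0)"
  by (subst path_mult_superset[of "{(u, p, v)}" "{(u', q, w)}"]) auto

lemma path_mult_zero [simp]: "path_mult 0 f = 0" "path_mult f 0 = 0"
  by (simp_all add: path_mult_def)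

lemma path_mult_sum_left: "path_mult (sum f A) g = (\<Sum>a\<in>A. path_mult (f a) g)"
  by (induction A rule: infinite_finite_induct) (auto simp: path_mult_add_left)

lemma path_mult_sum_right: "path_mult g (sum f A) = (\<Sum>a\<in>A. path_mult g (f a))"
  by (induction A rule: infinite_finite_induct) (auto simp: path_mult_add_right)

lemma single_sum_keys: "(f :: 'a \<Rightarrow>\<^sub>0 'b::comm_monoid_add) = (\<Sum>p\<in>Poly_Mapping.keys f. Poly_Mapping.single p (Poly_Mapping.lookup f p))"
  by (rule poly_mapping_eqI)
     (auto simp: lookup_sum lookup_single when_def sum.delta' in_keys_iff)

lemma single_induct [case_names zero single add]:
  fixes f :: "'a \<Rightarrow>\<^sub>0 'b::comm_monoid_add"
  assumes "P 0" "\<And>p x. p \<in> Poly_Mapping.keys f \<Longrightarrow> P (Poly_Mapping.single p x)" "\<And>f g. P f \<Longrightarrow> P g \<Longrightarrow> P (f + g)"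
  shows "P f"
proof -
  have "P (\<Sum>p\<in>A. Poly_Mapping.single p (Poly_Mapping.lookup f p))" if "finite A" "A \<subseteq> Poly_Mapping.keys f" for A
    using that by (induction A) (auto intro: assms)
  from this[OF finite_keys order_refl] show ?thesis by (simp only: single_sum_keys[of f, symmetric])
qed

lemma path_mult_assoc: "path_mult (path_mult f g) h = path_mult f (path_mult g h)"
proof (induction f rule: single_induct)
  case (single p x)
  obtain u1 p1 v1 where p: "p = (u1,p1,v1)" by (cases p)
  show ?case
  proof (induction g rule: single_induct)
    case (single q y)
    obtain u2 p2 v2 where q: "q = (u2,p2,v2)" by (cases q)
    show ?case
    proof (induction h rule: single_induct)
      case (single r z)
      obtain u3 p3 v3 where r: "r = (u3,p3,v3)" by (cases r)
      show ?case by (simp add: p q r path_mult_single mult.assoc)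
    qed (auto simp: path_mult_add_right)
  qed (auto simp: path_mult_add_left path_mult_add_right)
qed (auto simp: path_mult_add_left)

lemma ring_path_algebra:
  assumes "fin_digraph Q"
  shows "ring (path_algebra Q :: ('k::field, 'v \<times> 'e list \<times> 'v \<Rightarrow>\<^sub>0 'k) module)"
proof -
  interpret fin_digraph Q by (rule assms)
  let ?R = "path_algebra Q :: ('k::field, 'v \<times> 'e list \<times> 'v \<Rightarrow>\<^sub>0 'k) module"
  let ?C = "{f :: 'v \<times> 'e list \<times> 'v \<Rightarrow>\<^sub>0 'k. Poly_Mapping.keys f \<subseteq> quiver_paths Q}"
  let ?e = "\<Sum>v\<in>verts Q. Poly_Mapping.single (v, [], v) (1::'k)"
  have add: "f + g \<in> ?C" if "f \<in> ?C" "g \<in> ?C" for f g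
    using that Poly_Mapping.keys_add[of f g] by blast
  have mult: "path_mult f g \<in> ?C" if f: "f \<in> ?C" and g: "g \<in> ?C" for f g
  proof (induction f rule: single_induct)
    case (single p x)
    show ?case
    proof (induction g rule: single_induct)
      case s: (single q y)
      have "p \<in> quiver_paths Q" "q \<in> quiver_paths Q" using f g single s by auto
      then show ?case
        by (cases p; cases q) (auto simp: path_mult_single quiver_paths_def)
    qed (use add in \<open>auto simp: path_mult_add_right\<close>)
  qed (use add in \<open>auto simp: path_mult_add_left\<close>)
  have one: "?e \<in> ?C"
  proof -
    have "(\<Sum>v\<in>A. Poly_Mapping.single (v, [], v) (1::'k)) \<in> ?C" if "A \<subseteq> verts Q" for A :: "'v set"
      using that
    proof (induction A rule: infinite_finite_induct)
      case (insert x F)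
      then show ?case
        using add[of "Poly_Mapping.single (x, [], x) 1"] by (auto simp: quiver_paths_def awalk_Nil_iff)
    qed auto
    then show ?thesis by blast
  qed
  have one_left: "path_mult ?e f = f" if f: "f \<in> ?C" for f
  proof (induction f rule: single_induct)
    case (single p x)
    obtain u q w where p: "p = (u, q, w)" by (cases p)
    have "u \<in> verts Q" using f single p by (auto simp: quiver_paths_def awalk_def)
    then show ?case by (simp add: p path_mult_sum_left path_mult_single sum.delta)
  qed (auto simp: path_mult_add_right)
  have one_right: "path_mult f ?e = f" if f: "f \<in> ?C" for f
  proof (induction f rule: single_induct)
    case (single p x)
    obtain u q w where p: "p = (u, q, w)" by (cases p)
    have "(u, q, w) \<in> quiver_paths Q" using f single p by auto
    then have "w \<in> verts Q" by (auto simp: quiver_paths_def)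
    then show ?case by (simp add: p path_mult_sum_right path_mult_single sum.delta')
  qed (auto simp: path_mult_add_left)
  show ?thesis
  proof (rule ringI)
    show "abelian_group ?R"
    proof (rule abelian_groupI)
      fix f assume "f \<in> carrier ?R"
      then show "\<exists>g\<in>carrier ?R. g \<oplus>\<^bsub>?R\<^esub> f = \<zero>\<^bsub>?R\<^esub>"
        by (intro bexI[of _ "- f"]) (auto simp: path_algebra_def in_keys_iff)
    qed (use add in \<open>auto simp: path_algebra_def algebra_simps\<close>)
    show "Group.monoid ?R"
      by (rule monoidI) (use mult one one_left one_right in \<open>auto simp: path_algebra_def path_mult_assoc\<close>)
  qed (auto simp: path_algebra_def path_mult_add_left path_mult_add_right)
qed


section \<open>The algebras \<open>D\<^sub>3\<close>\<close>

datatype d3_gen = Gen_a | Gen_b | Gen_c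

definition d3_relations :: "'k::field \<Rightarrow> 'k \<Rightarrow> (d3_gen list \<Rightarrow>\<^sub>0 'k) set" where
  "d3_relations \<alpha>\<^sub>1 \<alpha>\<^sub>2 =
     (let a = free_gen Gen_a; b = free_gen Gen_b; c = free_gen Gen_c
      in {a * a - free_scalar \<alpha>\<^sub>1, b * b - free_scalar \<alpha>\<^sub>1, c * c - free_scalar \<alpha>\<^sub>1,
          c * a + b * c + a * b - free_scalar \<alpha>\<^sub>2,
          c * b + b * a + a * c - free_scalar \<alpha>\<^sub>2})"

definition D3 :: "'k::field \<Rightarrow> 'k \<Rightarrow> ('k, (d3_gen list \<Rightarrow>\<^sub>0 'k) set) module" where
  "D3 \<alpha>\<^sub>1 \<alpha>\<^sub>2 = quot_algebra free_algebra (Idl\<^bsub>free_algebra\<^esub> (d3_relations \<alpha>\<^sub>1 \<alpha>\<^sub>2))"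


section \<open>The preprojective algebra of type \<open>A\<^sub>2\<close>\<close>

datatype a2_vertex = V1 | V2

datatype a2_arrow = X | X_star

definition a2_double_quiver :: "(a2_vertex, a2_arrow) pre_digraph" where
  "a2_double_quiver = \<lparr>verts = {V1, V2}, arcs = {X, X_star},
                       tail = (\<lambda>e. case e of X \<Rightarrow> V1 | X_star \<Rightarrow> V2),
                       head = (\<lambda>e. case e of X \<Rightarrow> V2 | X_star \<Rightarrow> V1)\<rparr>"

lemma fin_digraph_a2_double_quiver: "fin_digraph a2_double_quiver"
  by unfold_locales (auto simp: a2_double_quiver_def split: a2_arrow.splits)

definition preprojective_A2_relations :: "(a2_vertex \<times> a2_arrow list \<times> a2_vertex \<Rightarrow>\<^sub>0 'k::field) set" where
  "preprojective_A2_relations =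
     {Poly_Mapping.single (V1, [X, X_star], V1) 1, Poly_Mapping.single (V2, [X_star, X], V2) 1}"

definition preprojective_A2 ::
  "('k::field, (a2_vertex \<times> a2_arrow list \<times> a2_vertex \<Rightarrow>\<^sub>0 'k) set) module" where
  "preprojective_A2 =
     quot_algebra (path_algebra a2_double_quiver)
       (Idl\<^bsub>path_algebra a2_double_quiver\<^esub> preprojective_A2_relations)"

end

(*
  The preprojective algebra has the basis e1, e2, x, x*. Put s = e1 - e2 and n = x + x*; then s s = 1,
  n n = 0 and s n = - n s. For b with b^2 = alpha1, sending two of the generators of
  D3(alpha1, - alpha1) to b s and the third one to b (- s + n) respects the relations, and the three
  choices of the third generator give a homomorphism to the product. On the other hand the
  relations give b a b = a b a + alpha1 (a - b) and allow to move c to the right, so that D3 is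
  spanned by the twelve words u and u c with u in {1, a, b, ab, ba, aba}. The homomorphism maps these
  twelve words to a basis: the matrix has an inverse with entries in Z[1/2].
*)
theory Submission
  imports Defs
begin

section \<open>Isomorphisms, products and quotients of algebras\<close>

lemma algebra_isomorphic_sym:
  assumes "ring A" "\<And>c x. x \<in> carrier A \<Longrightarrow> c \<odot>\<^bsub>A\<^esub> x \<in> carrier A"
    and "algebra_isomorphic A B"
  shows "algebra_isomorphic B A"
proof -
  obtain h where h: "h \<in> ring_iso A B" "\<And>c x. x \<in> carrier A \<Longrightarrow> h (c \<odot>\<^bsub>A\<^esub> x) = c \<odot>\<^bsub>B\<^esub> h x"
    using assms(3) by (auto simp: algebra_isomorphic_def algebra_iso_def)
  let ?g = "inv_into (carrier A) h"
  have bij: "bij_betw h (carrier A) (carrier B)"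
    using h(1) by (simp add: ring_iso_def)
  have "?g (c \<odot>\<^bsub>B\<^esub> y) = c \<odot>\<^bsub>A\<^esub> ?g y" if y: "y \<in> carrier B" for c y
  proof -
    obtain x where x: "x \<in> carrier A" "y = h x"
      using bij y by (auto simp: bij_betw_def)
    \<comment> \<open>Closure under scalars puts \<open>c \<odot> x\<close> in the carrier of
      \<open>A\<close>, the only place where \<open>inv_into\<close> undoes
      \<open>h\<close>.\<close>
    show ?thesis
      using x bij assms(2)[OF x(1), of c] by (simp add: h(2)[symmetric] bij_betw_inv_into_left)
  qed
  with ring_iso_set_sym[OF assms(1) h(1)] show ?thesis
    by (auto simp: algebra_isomorphic_def algebra_iso_def)
qed

lemma algebra_isomorphic_trans:
  assumes "algebra_isomorphic A B" "algebra_isomorphic B C"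
  shows "algebra_isomorphic A C"
proof -
  obtain g h where g: "g \<in> algebra_iso A B" and h: "h \<in> algebra_iso B C"
    using assms by (auto simp: algebra_isomorphic_def)
  have "g x \<in> carrier B" if "x \<in> carrier A" for x
    using g that by (auto simp: algebra_iso_def ring_iso_def ring_hom_def)
  with g h have "h \<circ> g \<in> algebra_iso A C"
    by (auto simp: algebra_iso_def intro: ring_iso_set_trans)
  then show ?thesis
    by (auto simp: algebra_isomorphic_def)
qed

lemma prod_algebra_simps [simp]:
  "carrier (prod_algebra A B) = carrier A \<times> carrier B"
  "\<one>\<^bsub>prod_algebra A B\<^esub> = (\<one>\<^bsub>A\<^esub>, \<one>\<^bsub>B\<^esub>)"
  "\<zero>\<^bsub>prod_algebra A B\<^esub> = (\<zero>\<^bsub>A\<^esub>, \<zero>\<^bsub>B\<^esub>)"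
  "(x, y) \<otimes>\<^bsub>prod_algebra A B\<^esub> (x', y') = (x \<otimes>\<^bsub>A\<^esub> x', y \<otimes>\<^bsub>B\<^esub> y')"
  "(x, y) \<oplus>\<^bsub>prod_algebra A B\<^esub> (x', y') = (x \<oplus>\<^bsub>A\<^esub> x', y \<oplus>\<^bsub>B\<^esub> y')"
  "c \<odot>\<^bsub>prod_algebra A B\<^esub> (x, y) = (c \<odot>\<^bsub>A\<^esub> x, c \<odot>\<^bsub>B\<^esub> y)"
  by (simp_all add: prod_algebra_def RDirProd_def DirProd_def ring.defs monoid.defs)

lemma ring_prod_algebra:
  assumes "ring A" "ring B"
  shows "ring (prod_algebra A B)"
proof -
  interpret A: ring A by fact
  interpret B: ring B by fact
  show ?thesis
  proof (rule ringI)
    show "abelian_group (prod_algebra A B)"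
      by (rule abelian_groupI)
        (auto simp: A.a_ac B.a_ac intro!: bexI[of _ "(\<ominus>\<^bsub>A\<^esub> x, \<ominus>\<^bsub>B\<^esub> y)" for x y] A.l_neg B.l_neg)
    show "Group.monoid (prod_algebra A B)"
      by (rule monoidI) (auto simp: A.m_assoc B.m_assoc)
  qed (auto simp: A.l_distr A.r_distr B.l_distr B.r_distr)
qed

lemma algebra_isomorphic_prod:
  assumes "algebra_isomorphic A A'" "algebra_isomorphic B B'"
  shows "algebra_isomorphic (prod_algebra A B) (prod_algebra A' B')"
proof -
  obtain g h where g: "g \<in> algebra_iso A A'" and h: "h \<in> algebra_iso B B'"
    using assms by (auto simp: algebra_isomorphic_def)
  have "bij_betw (map_prod g h) (carrier A \<times> carrier B) (carrier A' \<times> carrier B')"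
    using g h by (simp add: algebra_iso_def ring_iso_def bij_betw_map_prod)
  with g h have "map_prod g h \<in> algebra_iso (prod_algebra A B) (prod_algebra A' B')"
    by (auto simp: algebra_iso_def ring_iso_def ring_hom_def Pi_iff)
  then show ?thesis
    by (auto simp: algebra_isomorphic_def)
qed

lemma ring_quot_algebra:
  assumes "ideal I A"
  shows "ring (quot_algebra A I)"
proof -
  interpret ideal I A by fact
  \<comment> \<open>The quotient algebra is the quotient ring with one more record field, so the
    identity transports the ring axioms.\<close>
  have "id \<in> ring_iso (A Quot I) (quot_algebra A I)"
    by (simp add: ring_iso_def ring_hom_def quot_algebra_def ring.defs)
  from ring.ring_iso_imp_img_ring[OF quotient_is_ring this] show ?thesis
    by (simp add: quot_algebra_def ring.defs)
qed

lemma quot_algebra_smult_closed: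
  assumes I: "ideal I A"
    and clo: "\<And>x. x \<in> carrier A \<Longrightarrow> c \<odot>\<^bsub>A\<^esub> x \<in> carrier A"
    and dist: "\<And>x y. x \<in> carrier A \<Longrightarrow> y \<in> carrier A \<Longrightarrow>
      c \<odot>\<^bsub>A\<^esub> (x \<oplus>\<^bsub>A\<^esub> y) = c \<odot>\<^bsub>A\<^esub> x \<oplus>\<^bsub>A\<^esub> c \<odot>\<^bsub>A\<^esub> y"
    and assoc: "\<And>x. x \<in> carrier A \<Longrightarrow> c \<odot>\<^bsub>A\<^esub> x = (c \<odot>\<^bsub>A\<^esub> \<one>\<^bsub>A\<^esub>) \<otimes>\<^bsub>A\<^esub> x"
    and C: "C \<in> carrier (quot_algebra A I)"
  shows "c \<odot>\<^bsub>quot_algebra A I\<^esub> C \<in> carrier (quot_algebra A I)"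
proof -
  have carrier: "carrier (quot_algebra A I) = {I +>\<^bsub>A\<^esub> x | x. x \<in> carrier A}"
    by (auto simp: quot_algebra_def ring.defs FactRing_def A_RCOSETS_def')
  then obtain x where x: "x \<in> carrier A" "C = I +>\<^bsub>A\<^esub> x"
    using C by auto
  show ?thesis
    using quot_algebra_smult[OF I x(1) dist[OF _ x(1)] clo assoc] clo[OF x(1)]
    unfolding carrier x(2) by auto
qed

text \<open>The kernel is an ideal containing \<open>R\<close>, hence contains the smallest such
  ideal.\<close>

lemma genideal_in_kernel:
  assumes A: "ring A" and B: "ring B" and h: "h \<in> ring_hom A B"
    and R: "R \<subseteq> carrier A" "\<And>r. r \<in> R \<Longrightarrow> h r = \<zero>\<^bsub>B\<^esub>"
    and x: "x \<in> Idl\<^bsub>A\<^esub> R"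
  shows "h x = \<zero>\<^bsub>B\<^esub>"
proof -
  interpret ring_hom_ring A B h
    using A B h by (rule ring_hom_ringI2)
  have "R \<subseteq> a_kernel A B h"
    using R unfolding a_kernel_def' by blast
  from R.genideal_minimal[OF kernel_is_ideal this] x show ?thesis
    unfolding a_kernel_def' by blast
qed

text \<open>The first isomorphism theorem for an algebra given by relations: the relations vanish
  under \<open>h\<close>, and \<open>ker\<close> says that nothing else does. \<open>assoc\<close>
  expresses scalars through ring multiplication, which makes ideals stable under them.\<close>

lemma quot_algebra_isomorphic:
  assumes A: "ring A" and B: "ring B" and h: "h \<in> ring_hom A B"
    and surj: "h ` carrier A = carrier B"
    and R: "R \<subseteq> carrier A" "\<And>r. r \<in> R \<Longrightarrow> h r = \<zero>\<^bsub>B\<^esub>"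
    and ker: "\<And>x. x \<in> carrier A \<Longrightarrow> h x = \<zero>\<^bsub>B\<^esub> \<Longrightarrow> x \<in> Idl\<^bsub>A\<^esub> R"
    and smult: "\<And>c x. x \<in> carrier A \<Longrightarrow> h (c \<odot>\<^bsub>A\<^esub> x) = c \<odot>\<^bsub>B\<^esub> h x"
    and clo: "\<And>c x. x \<in> carrier A \<Longrightarrow> c \<odot>\<^bsub>A\<^esub> x \<in> carrier A"
    and dist: "\<And>c x y. x \<in> carrier A \<Longrightarrow> y \<in> carrier A \<Longrightarrow>
      c \<odot>\<^bsub>A\<^esub> (x \<oplus>\<^bsub>A\<^esub> y) = c \<odot>\<^bsub>A\<^esub> x \<oplus>\<^bsub>A\<^esub> c \<odot>\<^bsub>A\<^esub> y"
    and assoc: "\<And>c x. x \<in> carrier A \<Longrightarrow> c \<odot>\<^bsub>A\<^esub> x = (c \<odot>\<^bsub>A\<^esub> \<one>\<^bsub>A\<^esub>) \<otimes>\<^bsub>A\<^esub> x"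
  shows "algebra_isomorphic (quot_algebra A (Idl\<^bsub>A\<^esub> R)) B"
proof -
  interpret ring_hom_ring A B h
    using A B h by (rule ring_hom_ringI2)
  let ?I = "Idl\<^bsub>A\<^esub> R"
  \<comment> \<open>\<open>h\<close> is constant on each coset of its kernel, so the image of a
    coset is a singleton.\<close>
  let ?f = "\<lambda>X. the_elem (h ` X)"
  have kernel: "?I = a_kernel A B h"
  proof
    show "?I \<subseteq> a_kernel A B h"
      using genideal_in_kernel[OF A B h R] R.genideal_ideal[OF R(1)]
      unfolding a_kernel_def' by (blast dest: additive_subgroup.a_Hcarr[OF ideal.axioms(1)])
    show "a_kernel A B h \<subseteq> ?I"
      unfolding a_kernel_def' using ker by blast
  qed
  have I: "ideal ?I A"
    using kernel_is_ideal kernel by simp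
  have "?f \<in> ring_iso (A Quot ?I) B"
    using FactRing_iso_set[OF surj] by (simp add: kernel)
  then have iso: "?f \<in> ring_iso (quot_algebra A ?I) B"
    by (auto simp: ring_iso_def ring_hom_def quot_algebra_def ring.defs)
  have "?f (c \<odot>\<^bsub>quot_algebra A ?I\<^esub> X) = c \<odot>\<^bsub>B\<^esub> ?f X"
    if X: "X \<in> carrier (quot_algebra A ?I)" for c X
  proof -
    obtain x where x: "x \<in> carrier A" "X = ?I +>\<^bsub>A\<^esub> x"
      using X by (auto simp: quot_algebra_def ring.defs FactRing_def A_RCOSETS_def')
    have "c \<odot>\<^bsub>quot_algebra A ?I\<^esub> X = ?I +>\<^bsub>A\<^esub> (c \<odot>\<^bsub>A\<^esub> x)"
      unfolding x(2) by (rule quot_algebra_smult[OF I x(1) dist[OF _ x(1)] clo assoc])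
    then show ?thesis
      using x by (simp add: kernel smult clo)
  qed
  with iso show ?thesis
    by (auto simp: algebra_isomorphic_def algebra_iso_def)
qed

section \<open>Coordinates on the preprojective algebra\<close>

text \<open>\<open>PP p q r s\<close> stands for \<open>p e\<^sub>1 + q e\<^sub>2 + r x + s x\<^sup>*\<close>.\<close>

datatype 'k pp = PP 'k 'k 'k 'k

instantiation pp :: (comm_ring_1) ring_1
begin

definition zero_pp :: "'a pp" where "zero_pp = PP 0 0 0 0"
definition one_pp :: "'a pp" where "one_pp = PP 1 1 0 0"
fun plus_pp :: "'a pp \<Rightarrow> 'a pp \<Rightarrow> 'a pp" where
  "plus_pp (PP p q r s) (PP p' q' r' s') = PP (p + p') (q + q') (r + r') (s + s')"
fun minus_pp :: "'a pp \<Rightarrow> 'a pp \<Rightarrow> 'a pp" where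
  "minus_pp (PP p q r s) (PP p' q' r' s') = PP (p - p') (q - q') (r - r') (s - s')"
fun uminus_pp :: "'a pp \<Rightarrow> 'a pp" where
  "uminus_pp (PP p q r s) = PP (- p) (- q) (- r) (- s)"
text \<open>With the first factor traversed first, \<open>x\<close> satisfies e1 x = x = x e2 and
  the reversed arrow satisfies the same with 1 and 2 exchanged; products of two arrows
  vanish.\<close>

fun times_pp :: "'a pp \<Rightarrow> 'a pp \<Rightarrow> 'a pp" where
  "times_pp (PP p q r s) (PP p' q' r' s') = PP (p * p') (q * q') (p * r' + r * q') (q * s' + s * p')"

instance
proof
  fix x y z :: "'a pp"
  show "x + y + z = x + (y + z)" "x + y = y + x" "0 + x = x" "- x + x = 0" "x - y = x + - y"
    "x * y * z = x * (y * z)" "1 * x = x" "x * 1 = x" "(x + y) * z = x * z + y * z"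
    "x * (y + z) = x * y + x * z"
    by (cases x; cases y; cases z; simp add: zero_pp_def one_pp_def algebra_simps)+
qed (simp add: zero_pp_def one_pp_def)

end

text \<open>As 1 = e1 + e2, the element \<open>PP c c 0 0\<close> is the scalar c inside the ring.
  Writing scalars this way lets the ring laws handle them.\<close>

definition pp_algebra :: "('k::field, 'k pp) module" where
  "pp_algebra = \<lparr>carrier = UNIV, mult = (*), one = 1, zero = 0, add = (+),
                 smult = (\<lambda>c x. PP c c 0 0 * x)\<rparr>"

lemma pp_algebra_simps [simp]:
  "carrier pp_algebra = UNIV" "mult pp_algebra = (*)" "\<one>\<^bsub>pp_algebra\<^esub> = 1"
  "\<zero>\<^bsub>pp_algebra\<^esub> = 0" "add pp_algebra = (+)" "c \<odot>\<^bsub>pp_algebra\<^esub> x = PP c c 0 0 * x"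
  by (simp_all add: pp_algebra_def)

lemma ring_pp_algebra: "ring (pp_algebra :: ('k::field, 'k pp) module)"
proof (rule ringI)
  show "abelian_group (pp_algebra :: ('k, 'k pp) module)"
    by (rule abelian_groupI) (auto simp: algebra_simps intro: exI[of _ "- x" for x])
  show "Group.monoid (pp_algebra :: ('k, 'k pp) module)"
    by (rule monoidI) (auto simp: algebra_simps)
qed (auto simp: algebra_simps)

text \<open>Only the paths of length at most one are read; all longer paths lie in the ideal of
  relations.\<close>

definition path_coords ::
  "(a2_vertex \<times> a2_arrow list \<times> a2_vertex \<Rightarrow>\<^sub>0 'k::field) \<Rightarrow> 'k pp" where
  "path_coords f = PP (Poly_Mapping.lookup f (V1, [], V1)) (Poly_Mapping.lookup f (V2, [], V2))
     (Poly_Mapping.lookup f (V1, [X], V2)) (Poly_Mapping.lookup f (V2, [X_star], V1))"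

lemma path_coords_add: "path_coords (f + g) = path_coords f + path_coords g"
  by (simp add: path_coords_def lookup_add)

lemma path_coords_zero [simp]: "path_coords 0 = 0"
  by (simp add: path_coords_def zero_pp_def)

text \<open>Arrows must alternate, so a path of length at least two starts with one of the two
  relations. The last two cases are shaped for ideal membership: a relation times a path.\<close>

lemma a2_path_cases:
  assumes "p \<in> quiver_paths a2_double_quiver"
  obtains "p = (V1, [], V1)" | "p = (V2, [], V2)" | "p = (V1, [X], V2)" | "p = (V2, [X_star], V1)"
    | q v where "p = (V1, X # X_star # q, v)" "(V1, q, v) \<in> quiver_paths a2_double_quiver"
    | q v where "p = (V2, X_star # X # q, v)" "(V2, q, v) \<in> quiver_paths a2_double_quiver"
proof -
  interpret fin_digraph a2_double_quiver by (rule fin_digraph_a2_double_quiver)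
  obtain u es v where p: "p = (u, es, v)" by (cases p)
  then have w: "awalk u es v" using assms by (simp add: quiver_paths_def)
  have simps: "head a2_double_quiver X = V2" "head a2_double_quiver X_star = V1"
    "tail a2_double_quiver X = V1" "tail a2_double_quiver X_star = V2"
    by (simp_all add: a2_double_quiver_def)
  show thesis
  proof (cases es)
    case Nil
    then show thesis using w p that(1,2) by (cases u) (auto simp: awalk_Nil_iff)
  next
    case (Cons e es')
    note 1 = this
    show thesis
    proof (cases es')
      case Nil
      then show thesis using w p 1 that(3,4) 
        by (cases e) (auto simp: awalk_Cons_iff awalk_Nil_iff simps)
    next
      case (Cons e' q)
      then show thesis using w p 1 that(5,6)
        by (cases e; cases e') (auto simp: awalk_Cons_iff simps quiver_paths_def)
    qed
  qed
qed

text \<open>By bilinearity two single paths suffice. Restricting to actual paths matters: the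
  triples \<open>(V1, [], V2)\<close> and \<open>(V2, [], V1)\<close> have zero coordinates, but
  \<open>path_mult\<close> joins them to the trivial path at \<open>V1\<close>.\<close>

lemma path_coords_mult:
  assumes "Poly_Mapping.keys f \<subseteq> quiver_paths a2_double_quiver"
    and "Poly_Mapping.keys g \<subseteq> quiver_paths a2_double_quiver"
  shows "path_coords (path_mult f g) = path_coords f * path_coords g"
proof (induction f rule: single_induct)
  case p: (single p x)
  show ?case
  proof (induction g rule: single_induct)
    case q: (single q y)
    have p': "p \<in> quiver_paths a2_double_quiver" and q': "q \<in> quiver_paths a2_double_quiver"
      using p q assms by auto
    show ?case
      by (rule a2_path_cases[OF p']; rule a2_path_cases[OF q'])
        (auto simp: path_mult_single path_coords_def lookup_single when_def zero_pp_def)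
  qed (auto simp: path_mult_add_right path_coords_add algebra_simps)
qed (auto simp: path_mult_add_left path_coords_add algebra_simps)

section \<open>Scalar multiplication on path algebras\<close>

lemma map_times_zero [simp]: "Poly_Mapping.map ((*) c) 0 = (0 :: _ \<Rightarrow>\<^sub>0 'k::field)"
  by (rule poly_mapping_eqI) (simp add: Poly_Mapping.map.rep_eq)

lemma map_times_single: "Poly_Mapping.map ((*) c) (Poly_Mapping.single p x) = Poly_Mapping.single p (c * x :: 'k::field)"
  by (rule poly_mapping_eqI) (auto simp: Poly_Mapping.map.rep_eq lookup_single when_def)

lemma map_times_add: "Poly_Mapping.map ((*) c) (f + g) =
    Poly_Mapping.map ((*) c) f + Poly_Mapping.map ((*) (c::'k::field)) g"
  by (rule poly_mapping_eqI) (auto simp: Poly_Mapping.map.rep_eq lookup_add when_def algebra_simps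
      simp flip: distrib_left)

lemma path_mult_map_times_left:
  "path_mult (Poly_Mapping.map ((*) c) f) g = Poly_Mapping.map ((*) c) (path_mult f g)"
proof (induction f rule: single_induct)
  case (single p x)
  show ?case
  proof (induction g rule: single_induct)
    case (single q y)
    show ?case
      by (cases p; cases q) (simp add: map_times_single path_mult_single mult.assoc)
  qed (simp_all add: path_mult_add_right map_times_add)
qed (simp_all add: path_mult_add_left map_times_add)

lemma path_algebra_smult_closed:
  "f \<in> carrier (path_algebra Q) \<Longrightarrow> c \<odot>\<^bsub>path_algebra Q\<^esub> f \<in> carrier (path_algebra Q)"
  by (auto simp: path_algebra_def in_keys_iff Poly_Mapping.map.rep_eq when_def split: if_splits)

lemma path_algebra_smult_add:
  "c \<odot>\<^bsub>path_algebra Q\<^esub> (f \<oplus>\<^bsub>path_algebra Q\<^esub> g) =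
     c \<odot>\<^bsub>path_algebra Q\<^esub> f \<oplus>\<^bsub>path_algebra Q\<^esub> c \<odot>\<^bsub>path_algebra Q\<^esub> g"
  by (simp add: path_algebra_def map_times_add)

lemma path_algebra_smult_assoc:
  assumes "fin_digraph Q" "f \<in> carrier (path_algebra Q)"
  shows "c \<odot>\<^bsub>path_algebra Q\<^esub> f = (c \<odot>\<^bsub>path_algebra Q\<^esub> \<one>\<^bsub>path_algebra Q\<^esub>) \<otimes>\<^bsub>path_algebra Q\<^esub> f"
  using ring.ring_simprules(12)[OF ring_path_algebra[OF assms(1)] assms(2)]
  by (simp add: path_algebra_def path_mult_map_times_left)

lemma preprojective_A2_relations_carrier:
  "preprojective_A2_relations \<subseteq> carrier (path_algebra a2_double_quiver :: ('k::field, _) module)"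
proof -
  interpret fin_digraph a2_double_quiver by (rule fin_digraph_a2_double_quiver)
  have "(V1, [X, X_star], V1) \<in> quiver_paths a2_double_quiver"
    "(V2, [X_star, X], V2) \<in> quiver_paths a2_double_quiver"
    by (auto simp: quiver_paths_def awalk_Cons_iff awalk_Nil_iff) (auto simp: a2_double_quiver_def)
  then show ?thesis
    by (auto simp: preprojective_A2_relations_def path_algebra_def)
qed

lemma preprojective_A2_isomorphic:
  "algebra_isomorphic (preprojective_A2 :: ('k::field, _) module) pp_algebra"
  unfolding preprojective_A2_def
proof (rule quot_algebra_isomorphic)
  let ?P = "path_algebra a2_double_quiver :: ('k, _) module"
  let ?paths = "quiver_paths a2_double_quiver"
  let ?R = "preprojective_A2_relations :: (a2_vertex \<times> a2_arrow list \<times> a2_vertex \<Rightarrow>\<^sub>0 'k) set"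
  let ?s = "Poly_Mapping.single :: _ \<Rightarrow> 'k \<Rightarrow> _"
  interpret Q: fin_digraph a2_double_quiver by (rule fin_digraph_a2_double_quiver)
  show P: "ring ?P" by (rule ring_path_algebra[OF fin_digraph_a2_double_quiver])
  interpret ring ?P by (rule P)
  show "ring (pp_algebra :: ('k, 'k pp) module)" by (rule ring_pp_algebra)
  have carrier: "carrier ?P = {f. Poly_Mapping.keys f \<subseteq> ?paths}"
    and mult: "mult ?P = path_mult" and add: "add ?P = (+)" and zero: "\<zero>\<^bsub>?P\<^esub> = 0"
    and one: "\<one>\<^bsub>?P\<^esub> = ?s (V1, [], V1) 1 + ?s (V2, [], V2) 1"
    and smult: "smult ?P = (\<lambda>c. Poly_Mapping.map ((*) c))"
    by (simp_all add: path_algebra_def a2_double_quiver_def)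
  have coords_one: "path_coords \<one>\<^bsub>?P\<^esub> = 1"
    by (simp add: one path_coords_def lookup_add lookup_single one_pp_def)
  show "path_coords \<in> ring_hom ?P pp_algebra"
    by (rule ring_hom_memI)
      (simp_all add: coords_one, simp_all add: carrier mult add path_coords_mult path_coords_add)
  have paths: "(V1, [], V1) \<in> ?paths" "(V2, [], V2) \<in> ?paths"
    "(V1, [X], V2) \<in> ?paths" "(V2, [X_star], V1) \<in> ?paths"
    by (auto simp: quiver_paths_def Q.awalk_Cons_iff Q.awalk_Nil_iff)
      (auto simp: a2_double_quiver_def)
  have single: "?s p x \<in> carrier ?P" if "p \<in> ?paths" for p x
    using that by (auto simp: carrier)
  have single_add: "f + g \<in> carrier ?P" if "f \<in> carrier ?P" "g \<in> carrier ?P" for f g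
    using a_closed[OF that] by (simp add: add)
  show "path_coords ` carrier ?P = carrier pp_algebra"
  proof -
    have "t \<in> path_coords ` carrier ?P" for t
    proof -
      obtain p q r s where t: "t = PP p q r s" by (cases t)
      let ?f = "?s (V1, [], V1) p + ?s (V2, [], V2) q + ?s (V1, [X], V2) r + ?s (V2, [X_star], V1) s"
      have "path_coords ?f = t"
        by (simp add: t path_coords_def lookup_add lookup_single)
      moreover have "?f \<in> carrier ?P"
        by (intro single_add single paths)
      ultimately show ?thesis by blast
    qed
    then show ?thesis by auto
  qed
  show R: "?R \<subseteq> carrier ?P"
    by (rule preprojective_A2_relations_carrier)
  show "path_coords r = \<zero>\<^bsub>pp_algebra\<^esub>" if "r \<in> ?R" for r
    using that by (auto simp: preprojective_A2_relations_def path_coords_def lookup_single zero_pp_def)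
  let ?I = "Idl\<^bsub>?P\<^esub> ?R"
  interpret I: ideal ?I ?P by (rule genideal_ideal[OF R])
  have rel: "?s (V1, [X, X_star], V1) 1 \<in> ?I" "?s (V2, [X_star, X], V2) 1 \<in> ?I"
    using genideal_self[OF R] by (auto simp: preprojective_A2_relations_def)
  show "f \<in> ?I" if f: "f \<in> carrier ?P" "path_coords f = \<zero>\<^bsub>pp_algebra\<^esub>" for f
  proof -
    \<comment> \<open>The four short paths have coefficient zero in \<open>f\<close>; every other
      path is a relation times a path.\<close>
    have summand: "?s p (Poly_Mapping.lookup f p) \<in> ?I" if p: "p \<in> Poly_Mapping.keys f" for p
    proof -
      have "p \<in> ?paths" using f p by (auto simp: carrier)
      then show ?thesis
      proof (cases rule: a2_path_cases)
        case (5 q v)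
        from I.I_r_closed[OF rel(1) single[OF 5(2)]] show ?thesis
          by (simp add: 5(1) mult path_mult_single)
      next
        case (6 q v)
        from I.I_r_closed[OF rel(2) single[OF 6(2)]] show ?thesis
          by (simp add: 6(1) mult path_mult_single)
      qed (use f p in \<open>auto simp: path_coords_def zero_pp_def in_keys_iff\<close>)
    qed
    have "(\<Sum>p\<in>K. ?s p (Poly_Mapping.lookup f p)) \<in> ?I"
      if "finite K" "K \<subseteq> Poly_Mapping.keys f" for K
      using that
    proof (induction K)
      case empty
      then show ?case using I.zero_closed by (simp add: zero)
    next
      case (insert p K)
      then show ?case using I.a_closed[OF summand[of p]] by (simp add: add)
    qed
    from this[OF finite_keys order_refl] show ?thesis
      by (simp only: single_sum_keys[symmetric])
  qed
  show "path_coords (c \<odot>\<^bsub>?P\<^esub> f) = c \<odot>\<^bsub>pp_algebra\<^esub> path_coords f" for c f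
    by (simp add: smult path_coords_def Poly_Mapping.map.rep_eq when_def)
qed (simp_all only: path_algebra_smult_closed path_algebra_smult_add
    path_algebra_smult_assoc[OF fin_digraph_a2_double_quiver, symmetric])

lemma ideal_preprojective_A2_relations:
  "ideal (Idl\<^bsub>path_algebra a2_double_quiver\<^esub> preprojective_A2_relations)
     (path_algebra a2_double_quiver :: ('k::field, _) module)"
  by (rule ring.genideal_ideal[OF ring_path_algebra[OF fin_digraph_a2_double_quiver]
        preprojective_A2_relations_carrier])

text \<open>This and the closure under scalars that follows are what inverting the coordinate
  isomorphism requires.\<close>

lemma ring_preprojective_A2: "ring (preprojective_A2 :: ('k::field, _) module)"
  unfolding preprojective_A2_def by (rule ring_quot_algebra[OF ideal_preprojective_A2_relations])

lemma preprojective_A2_smult_closed: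
  "C \<in> carrier preprojective_A2 \<Longrightarrow> c \<odot>\<^bsub>preprojective_A2\<^esub> C \<in> carrier preprojective_A2"
  unfolding preprojective_A2_def
  by (rule quot_algebra_smult_closed[OF ideal_preprojective_A2_relations path_algebra_smult_closed
        path_algebra_smult_add path_algebra_smult_assoc[OF fin_digraph_a2_double_quiver]])

section \<open>Evaluating the free algebra\<close>

text \<open>Scalars are central. The trailing factor \<open>y\<close> makes the rule applicable
  inside right-nested products.\<close>

lemma pp_scalar_left_commute: "x * (PP c c 0 0 * y) = PP c c 0 0 * (x * y :: 'k::comm_ring_1 pp)"
  by (cases x; cases y) (simp add: algebra_simps)

lemma pp_scalar_scalar: "PP c c 0 0 * (PP d d 0 0 * x) = PP (c * d) (c * d) 0 0 * (x :: 'k::comm_ring_1 pp)"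
  by (cases x) (simp add: algebra_simps)

text \<open>The homomorphism that the universal property of the free algebra attaches to the
  assignment \<open>g\<close> of the generators.\<close>

definition pp_eval :: "('g \<Rightarrow> 'k::field pp) \<Rightarrow> ('g list \<Rightarrow>\<^sub>0 'k) \<Rightarrow> 'k pp" where
  "pp_eval g f = (\<Sum>w\<in>Poly_Mapping.keys f.
     PP (Poly_Mapping.lookup f w) (Poly_Mapping.lookup f w) 0 0 * prod_list (map g w))"

lemma pp_eval_zero [simp]: "pp_eval g 0 = 0"
  by (simp add: pp_eval_def)

lemma pp_scalar_zero: "PP 0 0 0 0 * x = (0 :: 'k::comm_ring_1 pp)"
  by (cases x) (simp add: zero_pp_def)

lemma pp_scalar_add: "PP (c + d) (c + d) 0 0 * x = PP c c 0 0 * x + PP d d 0 0 * (x :: 'k::comm_ring_1 pp)"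
  by (cases x) (simp add: algebra_simps)

text \<open>Coefficients outside the keys are zero, so two elements can be evaluated over one common
  index set.\<close>

lemma pp_eval_superset:
  assumes "finite K" "Poly_Mapping.keys f \<subseteq> K"
  shows "pp_eval g f = (\<Sum>w\<in>K.
    PP (Poly_Mapping.lookup f w) (Poly_Mapping.lookup f w) 0 0 * prod_list (map g w))"
  unfolding pp_eval_def
  by (rule sum.mono_neutral_left) (use assms in \<open>auto simp: in_keys_iff pp_scalar_zero\<close>)

lemma pp_eval_single [simp]:
  "pp_eval g (Poly_Mapping.single w x) = PP x x 0 0 * prod_list (map g w)"
  by (subst pp_eval_superset[of "{w}"]) auto

lemma pp_eval_add: "pp_eval g (e + f) = pp_eval g e + pp_eval g f"
  using Poly_Mapping.keys_add[of e f]
  by (simp add: pp_eval_superset[of "Poly_Mapping.keys e \<union> Poly_Mapping.keys f"] lookup_add pp_scalar_add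
      sum.distrib)

lemma pp_eval_minus: "pp_eval g (e - f) = pp_eval g e - pp_eval g f"
  using pp_eval_add[of g "e - f" f] by (simp add: algebra_simps)

lemma pp_eval_sum: "pp_eval g (\<Sum>i\<in>K. f i) = (\<Sum>i\<in>K. pp_eval g (f i))"
  by (induction K rule: infinite_finite_induct) (simp_all add: pp_eval_add)

text \<open>Both sides are bilinear, which leaves two single words; there concatenation becomes the
  product and the central scalars move to the front.\<close>

lemma pp_eval_mult: "pp_eval g (e * f) = pp_eval g e * pp_eval g f"
proof (induction e rule: single_induct)
  case (single v x)
  show ?case
  proof (induction f rule: single_induct)
    case (single w y)
    show ?case
      by (simp add: mult_single plus_list_def mult.assoc
          pp_scalar_left_commute[of "prod_list us" for us] pp_scalar_scalar)
  qed (simp_all add: pp_eval_add distrib_left)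
qed (simp_all add: pp_eval_add distrib_right)

lemma pp_eval_smult: "pp_eval g (Poly_Mapping.map ((*) c) f) = PP c c 0 0 * pp_eval g f"
proof (induction f rule: single_induct)
  case (single p x)
  show ?case
    by (simp add: map_times_single pp_scalar_scalar)
qed (simp_all add: map_times_add pp_eval_add distrib_left)

text \<open>Words are homogeneous. This separates the square root of alpha from a representation
  with integer entries.\<close>

lemma prod_list_pp_scalar:
  "prod_list (map (\<lambda>i. PP c c 0 0 * g i) w) =
     PP (c ^ length w) (c ^ length w) 0 0 * prod_list (map (g :: _ \<Rightarrow> 'k::field pp) w)"
proof (induction w)
  case (Cons i w)
  then show ?case
    by (simp add: mult.assoc pp_scalar_left_commute[of "g i"] pp_scalar_scalar)
qed (simp add: one_pp_def)

section \<open>A spanning set modulo the relations\<close>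

text \<open>The first six are reduced words for the symmetric group on three letters, with
  \<open>aba\<close> chosen over \<open>bab\<close>; the others append c. Twelve is also the
  dimension 3 * 4 of the product.\<close>

definition d3_words :: "d3_gen list set" where
  "d3_words = {[], [Gen_a], [Gen_b], [Gen_a, Gen_b], [Gen_b, Gen_a], [Gen_a, Gen_b, Gen_a],
     [Gen_c], [Gen_a, Gen_c], [Gen_b, Gen_c], [Gen_a, Gen_b, Gen_c], [Gen_b, Gen_a, Gen_c],
     [Gen_a, Gen_b, Gen_a, Gen_c]}"

lemma finite_d3_words: "finite d3_words"
  by (simp add: d3_words_def)

lemma free_scalar_commute: "free_scalar x * f = f * free_scalar x"
  by (induction f rule: single_induct)
    (auto simp: free_scalar_def mult_single plus_list_def algebra_simps)

lemma free_scalar_mult_single: "free_scalar x * Poly_Mapping.single w y = Poly_Mapping.single w (x * y)"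
  by (simp add: free_scalar_def mult_single plus_list_def)

lemma single_Nil_one: "Poly_Mapping.single [] 1 = 1"
  unfolding zero_list_def[symmetric] by (rule single_one)

lemma free_gen_mult_single:
  "free_gen g * Poly_Mapping.single w x = Poly_Mapping.single (g # w) x"
  by (simp add: free_gen_def mult_single plus_list_def)

text \<open>The elements congruent to a combination of the twelve words contain 1 and are stable
  under left multiplication by a, b and c, hence are everything. The ideal enters only through
  closure properties, so that the computations stay in a ring type.\<close>

lemma d3_words_span:
  fixes f :: "d3_gen list \<Rightarrow>\<^sub>0 'k::field"
  assumes I: "0 \<in> I" "\<And>x y. x \<in> I \<Longrightarrow> y \<in> I \<Longrightarrow> x + y \<in> I"
      "\<And>x y. x \<in> I \<Longrightarrow> y * x \<in> I" "\<And>x y. x \<in> I \<Longrightarrow> x * y \<in> I"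
    and rel: "d3_relations \<alpha> (- \<alpha>) \<subseteq> I"
  shows "\<exists>k. f - (\<Sum>w\<in>d3_words. Poly_Mapping.single w (k w)) \<in> I"
proof -
  let ?word = "\<lambda>w. Poly_Mapping.single w (1 :: 'k)"
  define a b c :: "d3_gen list \<Rightarrow>\<^sub>0 'k"
    where gens: "a = free_gen Gen_a" "b = free_gen Gen_b" "c = free_gen Gen_c"
  define z where z: "z = (free_scalar \<alpha> :: d3_gen list \<Rightarrow>\<^sub>0 'k)"
  have z_neg: "free_scalar (- \<alpha>) = - z"
    by (simp add: z free_scalar_def single_uminus)
  define S where "S f \<longleftrightarrow> (\<exists>k. f - (\<Sum>w\<in>d3_words. Poly_Mapping.single w (k w)) \<in> I)"
    for f :: "d3_gen list \<Rightarrow>\<^sub>0 'k"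
  have z_comm: "f * (z * g) = z * (f * g)" "f * z = z * f" for f g
    using free_scalar_commute[of \<alpha> f] by (simp_all add: z flip: mult.assoc)
  have rels: "a * a - z \<in> I" "b * b - z \<in> I" "c * c - z \<in> I"
    "c * a + b * c + a * b + z \<in> I" "c * b + b * a + a * c + z \<in> I"
    using rel by (simp_all add: d3_relations_def z_neg gens z Let_def)
  have S_add: "S (f + g)" if S: "S f" "S g" for f g
  proof -
    obtain k l where "f - (\<Sum>w\<in>d3_words. Poly_Mapping.single w (k w)) \<in> I"
      "g - (\<Sum>w\<in>d3_words. Poly_Mapping.single w (l w)) \<in> I"
      using S by (auto simp: S_def)
    from I(2)[OF this] show ?thesis
      unfolding S_def by (intro exI[of _ "\<lambda>w. k w + l w"]) (simp add: single_add sum.distrib algebra_simps)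
  qed
  have S_scalar: "S (free_scalar x * f)" if S: "S f" for x f
  proof -
    obtain k where "f - (\<Sum>w\<in>d3_words. Poly_Mapping.single w (k w)) \<in> I"
      using S by (auto simp: S_def)
    from I(3)[OF this, of "free_scalar x"] show ?thesis
      unfolding S_def
      by (intro exI[of _ "\<lambda>w. x * k w"]) (simp add: right_diff_distrib sum_distrib_left free_scalar_mult_single)
  qed
  have S_cong: "S f" if I': "f - g \<in> I" and S: "S g" for f g
  proof -
    obtain k where "g - (\<Sum>w\<in>d3_words. Poly_Mapping.single w (k w)) \<in> I"
      using S by (auto simp: S_def)
    from I(2)[OF I' this] show ?thesis
      unfolding S_def by auto
  qed
  have S_zero: "S 0"
    unfolding S_def by (intro exI[of _ "\<lambda>_. 0"]) (simp add: I)
  have S_uminus: "S (- f)" if "S f" for f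
    using S_scalar[OF that, of "- 1"] by (simp add: free_scalar_def single_uminus single_Nil_one)
  have S_diff: "S (f - g)" if "S f" "S g" for f g
    using S_add[OF that(1) S_uminus[OF that(2)]] by simp
  have S_sum: "S (sum f K)" if "\<And>i. i \<in> K \<Longrightarrow> S (f i)" for f and K :: "d3_gen list set"
    using that by (induction K rule: infinite_finite_induct) (simp_all add: S_zero S_add)
  have S_word: "S (?word w)" if "w \<in> d3_words" for w
    unfolding S_def
  proof
    have "(\<Sum>v\<in>d3_words. Poly_Mapping.single v (if v = w then 1 else 0 :: 'k)) =
        (\<Sum>v\<in>d3_words. if v = w then ?word v else 0)"
      by (rule sum.cong) auto
    then show "?word w - (\<Sum>v\<in>d3_words. Poly_Mapping.single v (if v = w then 1 else 0)) \<in> I"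
      using that by (simp add: finite_d3_words I)
  qed
  \<comment> \<open>Left multiplication by \<open>x\<close> is linear and preserves
    \<open>I\<close>, so stability has only to be checked on the twelve words.\<close>
  have S_mult: "S (x * f)" if x: "\<And>w. w \<in> d3_words \<Longrightarrow> S (x * ?word w)" and S: "S f" for x f
  proof -
    obtain k where k: "f - (\<Sum>w\<in>d3_words. Poly_Mapping.single w (k w)) \<in> I"
      using S by (auto simp: S_def)
    have "x * Poly_Mapping.single w (k w) = free_scalar (k w) * (x * ?word w)" for w
      using free_scalar_mult_single[of "k w" w 1] free_scalar_commute[of "k w" x]
      by (simp flip: mult.assoc) (simp add: mult.assoc)
    then have "S (\<Sum>w\<in>d3_words. x * Poly_Mapping.single w (k w))"
      using x by (auto intro!: S_sum S_scalar)
    then show ?thesis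
      by (rule S_cong[rotated]) (use I(3)[OF k, of x] in \<open>simp add: right_diff_distrib sum_distrib_left\<close>)
  qed
  note S_z = S_scalar[of _ \<alpha>, folded z]
  \<comment> \<open>A relation rewrites the prefix \<open>u * v\<close> to \<open>r\<close>,
    whatever word \<open>t\<close> follows.\<close>
  have reduce: "S (u * (v * t))" if "S (r * t)" "u * v - r \<in> I" for u v r t
    using that(1)
    by (rule S_cong[rotated]) (use I(4)[OF that(2), of t] in \<open>simp add: algebra_simps\<close>)
  have aa: "S (a * (a * t))" if "S t" for t
    using S_z[OF that] rels(1) by (rule reduce)
  have bb: "S (b * (b * t))" if "S t" for t
    using S_z[OF that] rels(2) by (rule reduce)
  have cc: "S (c * (c * t))" if "S t" for t
    using S_z[OF that] rels(3) by (rule reduce)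
  have words: "S 1" "S a" "S b" "S (a * b)" "S (b * a)" "S (a * (b * a))" "S c" "S (a * c)" "S (b * c)"
    "S (a * (b * c))" "S (b * (a * c))" "S (a * (b * (a * c)))"
    using S_word[of "[]"]
    by (simp_all add: S_word d3_words_def gens free_gen_def mult_single plus_list_def single_Nil_one)
  have word_eq: "?word [] = 1" "?word (Gen_a # w) = a * ?word w" "?word (Gen_b # w) = b * ?word w"
    "?word (Gen_c # w) = c * ?word w" for w
    by (simp_all add: gens free_gen_mult_single single_Nil_one)
  have a: "S (a * f)" if "S f" for f
    using _ that
  proof (rule S_mult)
    \<comment> \<open>A word starting with a is shortened by a a = alpha; any other word stays among
      the twelve when a is put in front.\<close>
    show "S (a * ?word w)" if "w \<in> d3_words" for w
      using that aa[of 1] words by (auto simp: d3_words_def word_eq intro: aa)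
  qed
  have bab_rel: "b * (a * b) - (a * (b * a) + z * a - z * b) \<in> I"
  proof -
    \<comment> \<open>Reduce \<open>c a a\<close> in two ways.\<close>
    have "b * (a * b) - (a * (b * a) + z * a - z * b) =
      c * (a * a - z) + b * (c * a + b * c + a * b + z) - (c * a + b * c + a * b + z) * a
       - (b * b - z) * c"
      by (simp add: algebra_simps z_comm)
    also have "\<dots> \<in> I"
      using I(2)[OF I(2)[OF I(2)[OF I(3)[OF rels(1), of c] I(3)[OF rels(4), of b]]
          I(4)[OF rels(4), of "- a"]] I(4)[OF rels(2), of "- c"]]
      by simp
    finally show ?thesis .
  qed
  \<comment> \<open>The hypotheses cover the three terms that rewriting b a b produces; the leading
    a of the first is absorbed by the stability under a.\<close>
  have bab: "S (b * (a * (b * t)))" if "S (b * (a * t))" "S t" "S (b * t)" for t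
  proof (rule S_cong)
    show "S (a * (b * (a * t)) + z * (a * t) - z * (b * t))"
      using that by (intro S_diff S_add S_z a)
    show "b * (a * (b * t)) - (a * (b * (a * t)) + z * (a * t) - z * (b * t)) \<in> I"
      using I(4)[OF bab_rel, of t] by (simp add: algebra_simps)
  qed
  have baa: "S (b * (a * (a * t)))" if "S (b * t)" for t
    using S_z[OF that]
    by (rule S_cong[rotated])
      (use I(3)[OF I(4)[OF rels(1), of t], of b] in \<open>simp add: algebra_simps z_comm\<close>)
  have b: "S (b * f)" if "S f" for f
    using _ that
  proof (rule S_mult)
    show "S (b * ?word w)" if "w \<in> d3_words" for w
      \<comment> \<open>The hard words are \<open>aba\<close> and \<open>abac\<close>: rewriting b a
        b leaves a term starting with b a a, which \<open>baa\<close> shortens.\<close>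
      using that bb[of 1] bab[of 1] baa[of 1] baa[of c] bab[of "a * c"] words
      by (auto simp: d3_words_def word_eq intro: bb bab baa)
  qed
  \<comment> \<open>The fourth relation reads c a = - alpha - b c - a b: c moves one letter to the
    right, and stability under a and b absorbs the letters put in front.\<close>
  have ca: "S (c * (a * t))" if "S t" "S (c * t)" for t
  proof (rule S_cong)
    show "S (- (z * t) - b * (c * t) - a * (b * t))"
      using that by (intro S_diff S_uminus S_z a b)
    show "c * (a * t) - (- (z * t) - b * (c * t) - a * (b * t)) \<in> I"
      using I(4)[OF rels(4), of t] by (simp add: algebra_simps)
  qed
  have cb: "S (c * (b * t))" if "S t" "S (c * t)" for t
  proof (rule S_cong)
    show "S (- (z * t) - b * (a * t) - a * (c * t))"
      using that by (intro S_diff S_uminus S_z a b)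
    show "c * (b * t) - (- (z * t) - b * (a * t) - a * (c * t)) \<in> I"
      using I(4)[OF rels(5), of t] by (simp add: algebra_simps)
  qed
  have c: "S (c * f)" if "S f" for f
    using _ that
  proof (rule S_mult)
    show "S (c * ?word w)" if "w \<in> d3_words" for w
      \<comment> \<open>The letter c travels right until it reaches the end of the word or a final
        c, where c c = alpha applies.\<close>
      using that ca[of 1] cb[of 1] cc[of 1] ca[of b] cb[of a] ca[of "b * a"] words
      by (auto simp: d3_words_def word_eq intro!: ca cb cc[of 1, simplified])
  qed
  have "S (?word w)" for w
  proof (induction w)
    case (Cons g w)
    then show ?case
      by (cases g) (simp_all add: word_eq a b c)
  qed (simp add: word_eq words)
  then have "S (Poly_Mapping.single w x)" for w x
    using S_scalar[of "?word w" x] by (simp add: free_scalar_mult_single)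
  then have "S f"
    by (induction f rule: single_induct) (simp_all add: S_zero S_add)
  then show ?thesis
    by (simp add: S_def)
qed

section \<open>The three representations\<close>

text \<open>
  The images of the generators in the \<open>i\<close>-th factor, up to a square root of \<open>\<alpha>\<^sub>1\<close>: the generator
  \<open>i\<close> acts as \<open>- (e\<^sub>1 - e\<^sub>2) + (x + x\<^sup>*)\<close>, and the other two generators as \<open>e\<^sub>1 - e\<^sub>2\<close>.
\<close>

definition d3_rep :: "d3_gen \<Rightarrow> d3_gen \<Rightarrow> 'k::field pp" where
  "d3_rep i j = (if j = i then PP (- 1) 1 1 1 else PP 1 (- 1) 0 0)"

text \<open>The square root of alpha is left out here and later absorbed into the coefficients
  \<open>y\<close>.\<close>

definition d3_comb :: "d3_gen \<Rightarrow> (d3_gen list \<Rightarrow> 'k) \<Rightarrow> 'k::field pp" where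
  "d3_comb i y = (\<Sum>w\<in>d3_words. PP (y w) (y w) 0 0 * prod_list (map (d3_rep i) w))"

lemma pp_eval_d3_words:
  "pp_eval (\<lambda>j. PP \<beta> \<beta> 0 0 * d3_rep i j) (\<Sum>w\<in>d3_words. Poly_Mapping.single w (k w)) =
     d3_comb i (\<lambda>w. k w * \<beta> ^ length w)"
  by (simp add: pp_eval_sum d3_comb_def prod_list_pp_scalar pp_scalar_scalar)

text \<open>The 12 by 12 integer matrix to be inverted: words are the columns, and each factor
  contributes four rows.\<close>

lemma d3_comb_simps:
  "d3_comb Gen_c y = PP
     (y [] + y [Gen_a] + y [Gen_b] + y [Gen_a, Gen_b] + y [Gen_b, Gen_a]
      + y [Gen_a, Gen_b, Gen_a] - y [Gen_c] - y [Gen_a, Gen_c] - y [Gen_b, Gen_c]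
      - y [Gen_a, Gen_b, Gen_c] - y [Gen_b, Gen_a, Gen_c] - y [Gen_a, Gen_b, Gen_a, Gen_c])
     (y [] - y [Gen_a] - y [Gen_b] + y [Gen_a, Gen_b] + y [Gen_b, Gen_a]
      - y [Gen_a, Gen_b, Gen_a] + y [Gen_c] - y [Gen_a, Gen_c] - y [Gen_b, Gen_c]
      + y [Gen_a, Gen_b, Gen_c] + y [Gen_b, Gen_a, Gen_c] - y [Gen_a, Gen_b, Gen_a, Gen_c])
     (y [Gen_c] + y [Gen_a, Gen_c] + y [Gen_b, Gen_c] + y [Gen_a, Gen_b, Gen_c]
      + y [Gen_b, Gen_a, Gen_c] + y [Gen_a, Gen_b, Gen_a, Gen_c])
     (y [Gen_c] - y [Gen_a, Gen_c] - y [Gen_b, Gen_c] + y [Gen_a, Gen_b, Gen_c]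
      + y [Gen_b, Gen_a, Gen_c] - y [Gen_a, Gen_b, Gen_a, Gen_c])"
  "d3_comb Gen_a y = PP
     (y [] - y [Gen_a] + y [Gen_b] - y [Gen_a, Gen_b] - y [Gen_b, Gen_a]
      + y [Gen_a, Gen_b, Gen_a] + y [Gen_c] - y [Gen_a, Gen_c] + y [Gen_b, Gen_c]
      - y [Gen_a, Gen_b, Gen_c] - y [Gen_b, Gen_a, Gen_c] + y [Gen_a, Gen_b, Gen_a, Gen_c])
     (y [] + y [Gen_a] - y [Gen_b] - y [Gen_a, Gen_b] - y [Gen_b, Gen_a]
      - y [Gen_a, Gen_b, Gen_a] - y [Gen_c] - y [Gen_a, Gen_c] + y [Gen_b, Gen_c]
      + y [Gen_a, Gen_b, Gen_c] + y [Gen_b, Gen_a, Gen_c] + y [Gen_a, Gen_b, Gen_a, Gen_c])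
     (y [Gen_a] - y [Gen_a, Gen_b] + y [Gen_b, Gen_a] - 2 * y [Gen_a, Gen_b, Gen_a]
      - y [Gen_a, Gen_c] + y [Gen_a, Gen_b, Gen_c] - y [Gen_b, Gen_a, Gen_c]
      + 2 * y [Gen_a, Gen_b, Gen_a, Gen_c])
     (y [Gen_a] + y [Gen_a, Gen_b] - y [Gen_b, Gen_a] - 2 * y [Gen_a, Gen_b, Gen_a]
      + y [Gen_a, Gen_c] + y [Gen_a, Gen_b, Gen_c] - y [Gen_b, Gen_a, Gen_c]
      - 2 * y [Gen_a, Gen_b, Gen_a, Gen_c])"
  "d3_comb Gen_b y = PP
     (y [] + y [Gen_a] - y [Gen_b] - y [Gen_a, Gen_b] - y [Gen_b, Gen_a]
      - y [Gen_a, Gen_b, Gen_a] + y [Gen_c] + y [Gen_a, Gen_c] - y [Gen_b, Gen_c]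
      - y [Gen_a, Gen_b, Gen_c] - y [Gen_b, Gen_a, Gen_c] - y [Gen_a, Gen_b, Gen_a, Gen_c])
     (y [] - y [Gen_a] + y [Gen_b] - y [Gen_a, Gen_b] - y [Gen_b, Gen_a]
      + y [Gen_a, Gen_b, Gen_a] - y [Gen_c] + y [Gen_a, Gen_c] - y [Gen_b, Gen_c]
      + y [Gen_a, Gen_b, Gen_c] + y [Gen_b, Gen_a, Gen_c] - y [Gen_a, Gen_b, Gen_a, Gen_c])
     (y [Gen_b] + y [Gen_a, Gen_b] - y [Gen_b, Gen_a] - y [Gen_a, Gen_b, Gen_a]
      - y [Gen_b, Gen_c] - y [Gen_a, Gen_b, Gen_c] + y [Gen_b, Gen_a, Gen_c]
      + y [Gen_a, Gen_b, Gen_a, Gen_c])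
     (y [Gen_b] - y [Gen_a, Gen_b] + y [Gen_b, Gen_a] - y [Gen_a, Gen_b, Gen_a]
      + y [Gen_b, Gen_c] - y [Gen_a, Gen_b, Gen_c] + y [Gen_b, Gen_a, Gen_c]
      - y [Gen_a, Gen_b, Gen_a, Gen_c])"
  by (simp_all add: d3_comb_def d3_words_def d3_rep_def one_pp_def algebra_simps)

text \<open>The coefficients are those of the inverse of the matrix of \<open>d3_comb\<close>, times \<open>8\<close>.\<close>

lemma d3_comb_eqD:
  fixes y :: "d3_gen list \<Rightarrow> 'k::field"
  assumes "d3_comb Gen_c y = PP p1 q1 r1 s1" "d3_comb Gen_a y = PP p2 q2 r2 s2"
    "d3_comb Gen_b y = PP p3 q3 r3 s3"
  shows
    "8 * y [] = 2 * p1 + 2 * q1 + 2 * r1 - 2 * s1 + p2 + q2 + p3 + q3"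
    "8 * y [Gen_a] = 2 * p1 - 2 * q1 + 2 * r1 + 2 * s1 - p2 + q2 + p3 - q3"
    "8 * y [Gen_b] = p1 - q1 + r1 + s1 + p2 - q2 + r2 + s2 - p3 + q3 + r3 + s3"
    "8 * y [Gen_a, Gen_b] = p1 + q1 + r1 - s1 - r2 + s2 - p3 - q3 + r3 - s3"
    "8 * y [Gen_b, Gen_a] = p1 + q1 + r1 - s1 - p2 - q2 + r2 - s2 - r3 + s3"
    "8 * y [Gen_a, Gen_b, Gen_a] = p1 - q1 + r1 + s1 - r2 - s2 - r3 - s3"
    "8 * y [Gen_c] = 2 * r1 + 2 * s1 + p2 - q2 + p3 - q3"
    "8 * y [Gen_a, Gen_c] = 2 * r1 - 2 * s1 - p2 - q2 + p3 + q3"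
    "8 * y [Gen_b, Gen_c] = r1 - s1 + p2 + q2 - r2 + s2 - p3 - q3 - r3 + s3"
    "8 * y [Gen_a, Gen_b, Gen_c] = r1 + s1 + r2 + s2 - p3 + q3 - r3 - s3"
    "8 * y [Gen_b, Gen_a, Gen_c] = r1 + s1 - p2 + q2 - r2 - s2 + r3 + s3"
    "8 * y [Gen_a, Gen_b, Gen_a, Gen_c] = r1 - s1 + r2 - s2 + r3 - s3"
  using assms[symmetric] by (simp_all only: d3_comb_simps pp.inject) (simp_all add: algebra_simps)

lemma d3_comb_surj:
  fixes p1 :: "'k::field"
  assumes "(8 :: 'k) \<noteq> 0"
  obtains y where "d3_comb Gen_c y = PP p1 q1 r1 s1" "d3_comb Gen_a y = PP p2 q2 r2 s2"
    "d3_comb Gen_b y = PP p3 q3 r3 s3"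
proof -
  \<comment> \<open>Targets multiplied by 8 admit a witness without division, namely the right-hand
    sides of \<open>d3_comb_eqD\<close>. Dividing the targets by 8 afterwards gives the
    claim.\<close>
  have *: "\<exists>y. d3_comb Gen_c y = PP (8 * p1) (8 * q1) (8 * r1) (8 * s1) \<and>
      d3_comb Gen_a y = PP (8 * p2) (8 * q2) (8 * r2) (8 * s2) \<and>
      d3_comb Gen_b y = PP (8 * p3) (8 * q3) (8 * r3) (8 * s3)"
    for p1 q1 r1 s1 p2 q2 r2 s2 p3 q3 r3 s3 :: 'k
    by (rule exI[of _ "(\<lambda>_. 0)(
      [] := 2 * p1 + 2 * q1 + 2 * r1 - 2 * s1 + p2 + q2 + p3 + q3,
      [Gen_a] := 2 * p1 - 2 * q1 + 2 * r1 + 2 * s1 - p2 + q2 + p3 - q3,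
      [Gen_b] := p1 - q1 + r1 + s1 + p2 - q2 + r2 + s2 - p3 + q3 + r3 + s3,
      [Gen_a, Gen_b] := p1 + q1 + r1 - s1 - r2 + s2 - p3 - q3 + r3 - s3,
      [Gen_b, Gen_a] := p1 + q1 + r1 - s1 - p2 - q2 + r2 - s2 - r3 + s3,
      [Gen_a, Gen_b, Gen_a] := p1 - q1 + r1 + s1 - r2 - s2 - r3 - s3,
      [Gen_c] := 2 * r1 + 2 * s1 + p2 - q2 + p3 - q3,
      [Gen_a, Gen_c] := 2 * r1 - 2 * s1 - p2 - q2 + p3 + q3,
      [Gen_b, Gen_c] := r1 - s1 + p2 + q2 - r2 + s2 - p3 - q3 - r3 + s3,
      [Gen_a, Gen_b, Gen_c] := r1 + s1 + r2 + s2 - p3 + q3 - r3 - s3,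
      [Gen_b, Gen_a, Gen_c] := r1 + s1 - p2 + q2 - r2 - s2 + r3 + s3,
      [Gen_a, Gen_b, Gen_a, Gen_c] := r1 - s1 + r2 - s2 + r3 - s3)"])
      (simp add: d3_comb_simps)
  show thesis
    using *[of "p1 / 8" "q1 / 8" "r1 / 8" "s1 / 8" "p2 / 8" "q2 / 8" "r2 / 8" "s2 / 8"
        "p3 / 8" "q3 / 8" "r3 / 8" "s3 / 8"] assms that by auto
qed

text \<open>Put s = e1 - e2 and t = - s + n, where n is the sum of the arrows. Then t t = 1 and s t
  + t s = - 2. In each mixed relation generator \<open>i\<close> is once a left and once a right
  factor, so the sum is s s + s t + t s = - 1, up to the factor alpha.\<close>

lemma d3_relations_pp_eval:
  assumes "\<beta>\<^sup>2 = \<alpha>" "r \<in> d3_relations \<alpha> (- \<alpha>)"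
  shows "pp_eval (\<lambda>j. PP \<beta> \<beta> 0 0 * d3_rep i j) r = 0"
  using assms(2) unfolding d3_relations_def Let_def assms(1)[symmetric]
  by (elim insertE emptyE; cases i)
    (simp_all add: pp_eval_minus pp_eval_add pp_eval_mult free_gen_def free_scalar_def d3_rep_def
      zero_pp_def one_pp_def power2_eq_square)

lemma pp_eval_one: "pp_eval g 1 = 1"
  using pp_eval_single[of g "[]" 1] by (simp add: single_Nil_one flip: one_pp_def)

section \<open>The isomorphism from D3 to the product\<close>

lemma free_algebra_simps [simp]:
  "carrier free_algebra = UNIV" "mult free_algebra = (*)" "\<one>\<^bsub>free_algebra\<^esub> = 1"
  "\<zero>\<^bsub>free_algebra\<^esub> = 0" "add free_algebra = (+)"
  "c \<odot>\<^bsub>free_algebra\<^esub> f = Poly_Mapping.map ((*) c) f"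
  by (simp_all add: free_algebra_def)

lemma D3_isomorphic:
  fixes \<alpha> \<beta> :: "'k::field"
  assumes two: "(2 :: 'k) \<noteq> 0" and \<beta>: "\<beta>\<^sup>2 = \<alpha>" "\<beta> \<noteq> 0"
  shows "algebra_isomorphic (D3 \<alpha> (- \<alpha>))
    (prod_algebra pp_algebra (prod_algebra pp_algebra pp_algebra))"
proof -
  \<comment> \<open>8 is the common denominator of the inverse matrix.\<close>
  have "(8 :: 'k) = 2 ^ 3"
    by simp
  then have eight: "(8 :: 'k) \<noteq> 0"
    using two by (metis power_not_zero)
  let ?F = "free_algebra :: ('k, d3_gen list \<Rightarrow>\<^sub>0 'k) module"
  let ?B = "prod_algebra pp_algebra (prod_algebra pp_algebra pp_algebra) ::
    ('k, 'k pp \<times> 'k pp \<times> 'k pp) module"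
  let ?R = "d3_relations \<alpha> (- \<alpha>)"
  let ?I = "Idl\<^bsub>?F\<^esub> ?R"
  define \<phi> where "\<phi> i = pp_eval (\<lambda>j. PP \<beta> \<beta> 0 0 * d3_rep i j)" for i
  define h where "h f = (\<phi> Gen_c f, \<phi> Gen_a f, \<phi> Gen_b f)" for f
  have \<phi>_words: "\<phi> i (\<Sum>w\<in>d3_words. Poly_Mapping.single w (k w)) = d3_comb i (\<lambda>w. k w * \<beta> ^ length w)"
    for i k
    by (simp add: \<phi>_def pp_eval_d3_words)
  interpret F: ring ?F
    by (rule ring_free_algebra)
  interpret I: ideal ?I ?F
    by (rule F.genideal_ideal) simp
  have rel: "?R \<subseteq> ?I"
    by (rule F.genideal_self) simp
  have h_rel: "h r = \<zero>\<^bsub>?B\<^esub>" if "r \<in> ?R" for r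
    using d3_relations_pp_eval[OF \<beta>(1) that] by (simp add: h_def \<phi>_def)
  have hom: "h \<in> ring_hom ?F ?B"
    by (rule ring_hom_memI)
      (simp_all add: h_def \<phi>_def pp_eval_add pp_eval_mult pp_eval_one)
  have B: "ring ?B"
    by (intro ring_prod_algebra ring_pp_algebra)
  show ?thesis
    unfolding D3_def
  proof (rule quot_algebra_isomorphic[OF ring_free_algebra B hom])
    show "h ` carrier ?F = carrier ?B"
    proof -
      have "t \<in> range h" for t
      proof -
        obtain p1 q1 r1 s1 p2 q2 r2 s2 p3 q3 r3 s3
          where t: "t = (PP p1 q1 r1 s1, PP p2 q2 r2 s2, PP p3 q3 r3 s3)"
          by (metis pp.exhaust prod.exhaust)
        obtain y where y: "d3_comb Gen_c y = PP p1 q1 r1 s1" "d3_comb Gen_a y = PP p2 q2 r2 s2"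
          "d3_comb Gen_b y = PP p3 q3 r3 s3"
          using d3_comb_surj[OF eight] .
        \<comment> \<open>Dividing by the power of \<beta> cancels the homogeneity factor of each
          word.\<close>
        have "t = h (\<Sum>w\<in>d3_words. Poly_Mapping.single w (y w / \<beta> ^ length w))"
          using \<beta>(2) by (simp add: h_def \<phi>_words t y)
        then show ?thesis
          by blast
      qed
      then show ?thesis
        by auto
    qed
    show "f \<in> ?I" if f: "h f = \<zero>\<^bsub>?B\<^esub>" for f
    \<comment> \<open>Modulo the ideal \<open>f\<close> is a combination of the twelve words. That
      combination is also killed by \<open>h\<close>, so the invertible matrix forces its
      coefficients to vanish.\<close>
    proof -
      obtain k where k: "f - (\<Sum>w\<in>d3_words. Poly_Mapping.single w (k w)) \<in> ?I"
        using d3_words_span[OF _ _ _ _ rel, of f] I.zero_closed I.a_closed I.I_l_closed I.I_r_closed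
        by auto
      let ?s = "\<Sum>w\<in>d3_words. Poly_Mapping.single w (k w)"
      have "h (f - ?s) = \<zero>\<^bsub>?B\<^esub>"
        using genideal_in_kernel[OF ring_free_algebra B hom _ h_rel k] by simp
      with f have "\<phi> i ?s = 0" for i
        by (cases i) (simp_all add: h_def \<phi>_def pp_eval_minus)
      then have "d3_comb i (\<lambda>w. k w * \<beta> ^ length w) = PP 0 0 0 0" for i
        by (simp add: \<phi>_words zero_pp_def)
      from d3_comb_eqD[OF this this this] have "k w = 0" if "w \<in> d3_words" for w
        using that eight \<beta>(2) by (auto simp: d3_words_def)
      then show ?thesis
        using k by simp
    qed
    show "c \<odot>\<^bsub>?F\<^esub> f = (c \<odot>\<^bsub>?F\<^esub> \<one>\<^bsub>?F\<^esub>) \<otimes>\<^bsub>?F\<^esub> f" for c f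
      by (induction f rule: single_induct)
        (simp_all add: map_times_single map_times_add distrib_left mult_single plus_list_def
          flip: single_Nil_one)
  qed (simp_all add: h_rel, simp_all add: h_def \<phi>_def pp_eval_smult map_times_add)
qed

theorem proposition2p16:
  fixes \<alpha>\<^sub>1 :: "'k::alg_closed_field"
  assumes "CHAR('k) \<noteq> 2"
    and "\<alpha>\<^sub>1 \<noteq> 0"
  shows "algebra_isomorphic (D3 \<alpha>\<^sub>1 (- \<alpha>\<^sub>1))
           (prod_algebra preprojective_A2 (prod_algebra preprojective_A2 preprojective_A2))"
proof -
  have two: "(2 :: 'k) \<noteq> 0"
  proof
    assume "(2 :: 'k) = 0"
    then have "CHAR('k) dvd 2"
      using of_nat_eq_0_iff_char_dvd[of 2, where ?'a = 'k] by simp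
    then show False
      using assms(1) CHAR_not_1[where ?'a = 'k] two_is_prime_nat by (auto simp: prime_nat_iff)
  qed
  \<comment> \<open>Algebraic closedness supplies the square root that scales the
    representations.\<close>
  obtain \<beta> where \<beta>: "\<beta>\<^sup>2 = \<alpha>\<^sub>1"
    using nth_root_exists[of 2 \<alpha>\<^sub>1] by auto
  with assms(2) have "\<beta> \<noteq> 0"
    by auto
  have "algebra_isomorphic (pp_algebra :: ('k, 'k pp) module) preprojective_A2"
    by (rule algebra_isomorphic_sym[OF ring_preprojective_A2 preprojective_A2_smult_closed
          preprojective_A2_isomorphic])
  then show ?thesis
    by (intro algebra_isomorphic_trans[OF D3_isomorphic[OF two \<beta> \<open>\<beta> \<noteq> 0\<close>]]
        algebra_isomorphic_prod)
qed

end
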